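(* Let $d=1$. Fix $p\in[1,+\infty)$ and $a,b$ such that $0<a\le 1\le b^{-1}<+\infty$. Then the function $$\mathcal{D}^\star_{\mathrm{hom}}(q)=e^{V(q)}$$ is a maximizer of $\mathcal{D}\mapsto\Lambda_{\mathrm{hom}}(\mathcal{D})$ over $\mathfrak{D}_p^{a,b}$, i.e. $\mathcal{D}^\star_{\mathrm{hom}}\in\mathfrak{D}_p^{a,b}$ and $\Lambda_{\mathrm{hom}}(\mathcal{D}^\star_{\mathrm{hom}})=\sup_{\mathcal{D}\in\mathfrak{D}_p^{a,b}}\Lambda_{\mathrm{hom}}(\mathcal{D})$.
   Context: Notation (in dimension $d=1$). $\mathbb{T}=\mathbb{R}/\mathbb{Z}$, $V\in C^\infty(\mathbb{T})$ is real-valued, $Z=\int_{\mathbb{T}}e^{-V}$. $\mathfrak{D}_p^{a,b}$ is the set of measurable functions $\mathcal{D}:\mathbb{T}\to[0,+\infty)$ such that $a\le\mathcal{D}(q)e^{-V(q)}\le b^{-1}$ for a.e. $q\in\mathbb{T}$ and $\int_{\mathbb{T}}\mathcal{D}(q)^p e^{-pV(q)}\,dq\le 1$. For $\mathcal{D}\in\mathfrak{D}_p^{a,b}$, let $\mathcal{A}(q)=\mathcal{D}(q)e^{-V(q)}$ and let $w\in H^1(\mathbb{T})$ be the unique solution of $-(\mathcal{A}(1+w'))'=0$ on $\mathbb{T}$ (weakly) with $\int_{\mathbb{T}}w=0$. Define the homogenized coefficients $\overline{\mathcal{A}}=\int_{\mathbb{T}}\mathcal{A}(q)(1+w'(q))^2\,dq$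 and $\overline{\mathcal{D}}=Z^{-1}\overline{\mathcal{A}}$, and $$\Lambda_{\mathrm{hom}}(\mathcal{D})=\inf_{u\in H^{1,0}(\mathbb{T})\setminus\{0\}}\frac{\int_{\mathbb{T}}\overline{\mathcal{D}}\,u'(q)^2\,dq}{\int_{\mathbb{T}}u(q)^2\,dq},$$ where $H^{1,0}(\mathbb{T})=\{u\in H^1(\mathbb{T}):\int_{\mathbb{T}}u=0\}$. *)

theory Defs
  imports "HOL-Analysis.Analysis"
begin

text \<open>
  A function on the torus \<open>\<real>/\<int>\<close> is a 1-periodic function on the real line
  (\<open>periodic_fun_simple'\<close>). Integrals and ``almost everywhere'' refer to Lebesgue
  measure on the fundamental domain.
\<close>

abbreviation torus :: "real measure" where
  "torus \<equiv> lebesgue_on {0..1}"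

definition smooth_torus :: "(real \<Rightarrow> real) \<Rightarrow> bool" where
  "smooth_torus f \<longleftrightarrow>
     periodic_fun_simple' f \<and> (\<forall>n. ((deriv ^^ n) f) differentiable_on UNIV)"

text \<open>
  Elements of \<open>L\<^sup>2\<close> and \<open>H\<^sup>1\<close> are represented by functions, not by classes modulo
  almost everywhere equality.
\<close>

definition L2_torus :: "(real \<Rightarrow> real) set" where
  "L2_torus = {f. periodic_fun_simple' f \<and> f \<in> borel_measurable torus \<and>
                  integrable torus (\<lambda>q. (f q)\<^sup>2)}"

definition has_weak_deriv :: "(real \<Rightarrow> real) \<Rightarrow> (real \<Rightarrow> real) \<Rightarrow> bool" where
  "has_weak_deriv u g \<longleftrightarrow>
     (\<forall>\<phi>. smooth_torus \<phi> \<longrightarrow>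
        (LINT q|torus. u q * deriv \<phi> q) = - (LINT q|torus. g q * \<phi> q))"

definition H1_torus :: "(real \<Rightarrow> real) set" where
  "H1_torus = {u \<in> L2_torus. \<exists>g \<in> L2_torus. has_weak_deriv u g}"

text \<open>
  The weak derivative of an \<open>H\<^sup>1\<close> function is unique almost everywhere; any representative
  is chosen. It is used only under integrals.
\<close>

definition weak_deriv :: "(real \<Rightarrow> real) \<Rightarrow> real \<Rightarrow> real" where
  "weak_deriv u = (SOME g. g \<in> L2_torus \<and> has_weak_deriv u g)"

definition H10_torus :: "(real \<Rightarrow> real) set" where
  "H10_torus = {u \<in> H1_torus. (LINT q|torus. u q) = 0}"

definition partition_const :: "(real \<Rightarrow> real) \<Rightarrow> real" where
  "partition_const V = (LINT q|torus. exp (- V q))"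

definition diffusion_set :: "(real \<Rightarrow> real) \<Rightarrow> real \<Rightarrow> real \<Rightarrow> real \<Rightarrow> (real \<Rightarrow> real) set" where
  "diffusion_set V p a b =
     {D. periodic_fun_simple' D \<and> D \<in> borel_measurable lebesgue \<and> (\<forall>q. 0 \<le> D q) \<and>
         (AE q in torus. a \<le> D q * exp (- V q) \<and> D q * exp (- V q) \<le> inverse b) \<and>
         (LINT q|torus. D q powr p * exp (- p * V q)) \<le> 1}"

definition weighted_diffusion :: "(real \<Rightarrow> real) \<Rightarrow> (real \<Rightarrow> real) \<Rightarrow> real \<Rightarrow> real" where
  "weighted_diffusion V D q = D q * exp (- V q)"

text \<open>
  Weak form of \<open>-(A (1 + w'))' = 0\<close> with zero mean. For \<open>A\<close> bounded and bounded away from 0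
  the solution exists and is unique up to a null set.
\<close>

definition is_corrector :: "(real \<Rightarrow> real) \<Rightarrow> (real \<Rightarrow> real) \<Rightarrow> bool" where
  "is_corrector A w \<longleftrightarrow>
     w \<in> H1_torus \<and> (LINT q|torus. w q) = 0 \<and>
     (\<forall>\<phi> \<in> H1_torus. (LINT q|torus. A q * (1 + weak_deriv w q) * weak_deriv \<phi> q) = 0)"

definition corrector :: "(real \<Rightarrow> real) \<Rightarrow> real \<Rightarrow> real" where
  "corrector A = (SOME w. is_corrector A w)"

definition A_hom :: "(real \<Rightarrow> real) \<Rightarrow> real" where
  "A_hom A = (LINT q|torus. A q * (1 + weak_deriv (corrector A) q)\<^sup>2)"

definition D_hom :: "(real \<Rightarrow> real) \<Rightarrow> (real \<Rightarrow> real) \<Rightarrow> real" where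
  "D_hom V D = inverse (partition_const V) * A_hom (weighted_diffusion V D)"

definition Lambda_hom :: "(real \<Rightarrow> real) \<Rightarrow> (real \<Rightarrow> real) \<Rightarrow> real" where
  "Lambda_hom V D =
     (INF u \<in> {u \<in> H10_torus. \<not> (AE q in torus. u q = 0)}.
        (LINT q|torus. D_hom V D * (weak_deriv u q)\<^sup>2) / (LINT q|torus. (u q)\<^sup>2))"

end

theory Submission
  imports Defs
begin

text \<open>
  \<open>\<Lambda>\<^sub>h\<^sub>o\<^sub>m\<close> is the homogenized diffusion times a fixed nonnegative Rayleigh infimum, so it
  suffices to maximize the homogenized coefficient of \<open>A = D e\<^sup>-\<^sup>V\<close>. The corrector equation tested
  against the corrector gives \<open>\<integral> A (1 + w')\<^sup>2 = \<integral> A - \<integral> A w'\<^sup>2 \<le> \<integral> A\<close>, and \<open>\<integral> A \<le> 1\<close> follows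
  from the constraint on \<open>\<integral> A\<^sup>p\<close> by Young's inequality. For \<open>D = e\<^sup>V\<close> one has \<open>A = 1\<close>, \<open>w' = 0\<close>, and
  equality throughout. As \<open>w\<close> and \<open>w'\<close> are picked by choice, correctors must be shown to exist and
  weak derivatives to be unique almost everywhere.
\<close>

section \<open>Trigonometric polynomials as test functions\<close>

text \<open>An algebra of 1-periodic functions closed under differentiation, hence made of test
  functions, and rich enough to approximate indicators of intervals. It takes the place of bump
  functions.\<close>

inductive trig_poly :: "(real \<Rightarrow> real) \<Rightarrow> bool" where
  const: "trig_poly (\<lambda>x. c)"
| cos: "trig_poly (\<lambda>x. cos (2 * pi * x))"
| sin: "trig_poly (\<lambda>x. sin (2 * pi * x))"
| add: "trig_poly f \<Longrightarrow> trig_poly g \<Longrightarrow> trig_poly (\<lambda>x. f x + g x)"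
| mult: "trig_poly f \<Longrightarrow> trig_poly g \<Longrightarrow> trig_poly (\<lambda>x. f x * g x)"

lemma trig_poly_periodic: "trig_poly f \<Longrightarrow> f (x + 1) = f x"
  by (induction rule: trig_poly.induct) (auto simp: distrib_left sin_add cos_add)

lemma trig_poly_has_derivative:
  assumes "trig_poly f"
  obtains f' where "trig_poly f'" "\<And>x. (f has_real_derivative f' x) (at x)"
proof -
  have "\<exists>f'. trig_poly f' \<and> (\<forall>x. (f has_real_derivative f' x) (at x))"
    using assms
  proof (induction rule: trig_poly.induct)
    case (const c)
    show ?case
      by (rule exI[of _ "\<lambda>x. 0"]) (auto intro: trig_poly.intros)
  next
    case cos
    show ?case
      by (rule exI[of _ "\<lambda>x. (- 2 * pi) * sin (2 * pi * x)"])
         (intro conjI allI trig_poly.mult trig_poly.const trig_poly.sin;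
          auto intro!: derivative_eq_intros)
  next
    case sin
    show ?case
      by (rule exI[of _ "\<lambda>x. (2 * pi) * cos (2 * pi * x)"])
         (auto intro!: trig_poly.mult trig_poly.const trig_poly.cos derivative_eq_intros)
  next
    case (add f g)
    then obtain f' g' where
      "trig_poly f'" "\<And>x. (f has_real_derivative f' x) (at x)"
      "trig_poly g'" "\<And>x. (g has_real_derivative g' x) (at x)"
      by blast
    then show ?case
      by (intro exI[of _ "\<lambda>x. f' x + g' x"]) (auto intro: trig_poly.add DERIV_add)
  next
    case (mult f g)
    then obtain f' g' where
      "trig_poly f'" "\<And>x. (f has_real_derivative f' x) (at x)"
      "trig_poly g'" "\<And>x. (g has_real_derivative g' x) (at x)"
      by blast
    with mult.hyps show ?case
      by (intro exI[of _ "\<lambda>x. f' x * g x + g' x * f x"])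
         (auto intro!: trig_poly.add trig_poly.mult DERIV_mult)
  qed
  with that show thesis by blast
qed

lemma trig_poly_deriv:
  assumes "trig_poly f"
  shows "trig_poly (deriv f)" "f differentiable_on UNIV"
proof -
  obtain f' where f': "trig_poly f'" "\<And>x. (f has_real_derivative f' x) (at x)"
    using trig_poly_has_derivative[OF assms] by blast
  then have "deriv f = f'"
    by (auto intro: DERIV_imp_deriv)
  with f' show "trig_poly (deriv f)" by simp
  show "f differentiable_on UNIV"
    using f'(2) real_differentiable_def by (auto simp: differentiable_on_def)
qed

lemma trig_poly_smooth:
  assumes "trig_poly f"
  shows "smooth_torus f"
proof -
  have "trig_poly ((deriv ^^ n) f)" for n
    by (induction n) (auto intro: assms trig_poly_deriv)
  then show ?thesis
    by (auto simp: smooth_torus_def periodic_fun_simple'_def trig_poly_periodic[OF assms]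
        intro: trig_poly_deriv)
qed

lemma trig_poly_compose_polynomial:
  assumes "real_polynomial_function P" "trig_poly f"
  shows "trig_poly (\<lambda>x. P (f x))"
  using assms(1)
proof (induction rule: real_polynomial_function.induct)
  case (linear L)
  have "L (f x) = L 1 * f x" for x
    using linear_cmul[OF bounded_linear.linear[OF linear], of "f x" 1] by simp
  then show ?case
    by (simp add: trig_poly.mult trig_poly.const assms(2))
qed (auto intro: trig_poly.intros)

text \<open>On \<open>[0,1]\<close> this trigonometric polynomial is positive exactly on \<open>]c,d[\<close>.\<close>

definition arc_fun :: "real \<Rightarrow> real \<Rightarrow> real \<Rightarrow> real" where
  "arc_fun c d x = sin (pi * (x - c)) * sin (pi * (d - x))"

lemma trig_poly_arc_fun: "trig_poly (arc_fun c d)"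
proof -
  \<comment> \<open>Each sine factor has period 2 only; the product-to-sum formula leaves a constant
    and a cosine of frequency one.\<close>
  have eq: "arc_fun c d = (\<lambda>x. (cos (pi * (c + d)) / 2) * cos (2 * pi * x)
      + ((sin (pi * (c + d)) / 2) * sin (2 * pi * x) + - cos (pi * (d - c)) / 2))"
  proof
    fix x
    have "arc_fun c d x = (cos (2 * pi * x - pi * (c + d)) - cos (pi * (d - c))) / 2"
      unfolding arc_fun_def sin_times_sin by (simp add: algebra_simps)
    then show "arc_fun c d x = (cos (pi * (c + d)) / 2) * cos (2 * pi * x)
      + ((sin (pi * (c + d)) / 2) * sin (2 * pi * x) + - cos (pi * (d - c)) / 2)"
      by (simp add: cos_diff field_simps)
  qed
  show ?thesis
    unfolding eq by (intro trig_poly.intros)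
qed

lemma abs_arc_fun_le: "\<bar>arc_fun c d x\<bar> \<le> 1"
  by (simp add: arc_fun_def abs_mult mult_le_one)

text \<open>For points of \<open>[0,1]\<close> both \<open>x - c\<close> and \<open>d - x\<close>
  lie in \<open>[-1,1]\<close>, where \<open>sin (pi * t)\<close> is positive inside the right half
  and nonpositive on the left half. Since \<open>c \<le> d\<close>, if one difference is nonpositive
  the other is nonnegative.\<close>

lemma arc_fun_pos_iff:
  assumes "0 \<le> c" "c \<le> d" "d \<le> 1" "0 \<le> x" "x \<le> 1"
  shows "0 < arc_fun c d x \<longleftrightarrow> c < x \<and> x < d"
proof -
  have sin_pos: "0 < sin (pi * t)" if "0 < t" "t < 1" for t
    using that by (intro sin_gt_zero) auto
  have sin_nonneg: "0 \<le> sin (pi * t)" if "0 \<le> t" "t \<le> 1" for t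
    using that by (intro sin_ge_zero) auto
  have sin_nonpos: "sin (pi * t) \<le> 0" if "- 1 \<le> t" "t \<le> 0" for t
    using sin_nonneg[of "- t"] that by simp
  consider "x \<le> c" | "d \<le> x" | "c < x" "x < d" by linarith
  then show ?thesis
  proof cases
    case 1
    then have "arc_fun c d x \<le> 0"
      unfolding arc_fun_def using assms
      by (intro mult_nonpos_nonneg sin_nonneg sin_nonpos) auto
    with 1 show ?thesis by auto
  next
    case 2
    then have "arc_fun c d x \<le> 0"
      unfolding arc_fun_def using assms
      by (intro mult_nonneg_nonpos sin_nonneg sin_nonpos) auto
    with 2 show ?thesis by auto
  next
    case 3
    then have "0 < arc_fun c d x"
      unfolding arc_fun_def using assms by (intro mult_pos_pos sin_pos) auto
    with 3 show ?thesis by auto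
  qed
qed

text \<open>The indicator of an arc is the indicator of \<open>t > 0\<close> composed with
  \<open>arc_fun\<close>. A continuous approximation of the former is replaced by Weierstrass
  polynomials on \<open>[-1,1]\<close>, which contains the range of \<open>arc_fun\<close>. The
  uniform bound 2 is there for dominated convergence.\<close>

lemma indicator_limit_of_trig_polys:
  assumes "0 \<le> c" "c \<le> d" "d \<le> 1"
  obtains \<phi> :: "nat \<Rightarrow> real \<Rightarrow> real"
  where "\<And>n. trig_poly (\<phi> n)" "\<And>n x. \<bar>\<phi> n x\<bar> \<le> 2"
    "\<And>x. x \<in> {0..1} \<Longrightarrow> (\<lambda>n. \<phi> n x) \<longlonglongrightarrow> indicator {c<..<d} x"
proof -
  \<comment> \<open>A truncated ramp: 0 for \<open>t \<le> 0\<close> and 1 as soon as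
    \<open>n * t \<ge> 1\<close>, so its pointwise limit is the indicator of
    \<open>t > 0\<close>.\<close>
  define G :: "nat \<Rightarrow> real \<Rightarrow> real" where "G n t = min 1 (max 0 (real n * t))" for n t
  have "\<exists>P. real_polynomial_function P \<and> (\<forall>t \<in> {- 1..1}. \<bar>G n t - P t\<bar> < 1 / Suc n)" for n
  proof -
    have "continuous_on {- 1..1} (G n)"
      unfolding G_def by (intro continuous_intros)
    then show ?thesis
      by (meson Stone_Weierstrass_real_polynomial_function compact_Icc of_nat_0_less_iff
          zero_less_Suc zero_less_divide_1_iff)
  qed
  then obtain P where P: "\<And>n. real_polynomial_function (P n)"
      "\<And>n t. t \<in> {- 1..1} \<Longrightarrow> \<bar>G n t - P n t\<bar> < 1 / Suc n"
    by metis
  have arc: "arc_fun c d x \<in> {- 1..1}" for x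
    using abs_arc_fun_le[of c d x] by auto
  define \<phi> where "\<phi> n x = P n (arc_fun c d x)" for n x
  have close: "\<bar>G n (arc_fun c d x) - \<phi> n x\<bar> < 1 / Suc n" for n x
    unfolding \<phi>_def by (rule P(2)[OF arc])
  show thesis
  proof
    show "trig_poly (\<phi> n)" for n
      unfolding \<phi>_def by (rule trig_poly_compose_polynomial[OF P(1) trig_poly_arc_fun])
    show "\<bar>\<phi> n x\<bar> \<le> 2" for n x
    proof -
      have "1 / real (Suc n) \<le> 1" by simp
      moreover have "0 \<le> G n (arc_fun c d x)" "G n (arc_fun c d x) \<le> 1"
        by (auto simp: G_def)
      ultimately show ?thesis using close[of n x] by linarith
    qed
    fix x :: real assume x: "x \<in> {0..1}"
    have "(\<lambda>n. G n (arc_fun c d x)) \<longlonglongrightarrow> indicator {c<..<d} x"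
    proof (cases "0 < arc_fun c d x")
      case True
      have "\<forall>\<^sub>F n in sequentially. 1 / arc_fun c d x \<le> real n"
        by (intro eventually_sequentiallyI[of "nat \<lceil>1 / arc_fun c d x\<rceil>"]) linarith
      then have "\<forall>\<^sub>F n in sequentially. G n (arc_fun c d x) = 1"
        by eventually_elim (use True in \<open>auto simp: G_def field_simps\<close>)
      moreover have "x \<in> {c<..<d}"
        using True arc_fun_pos_iff[OF assms] x by auto
      ultimately show ?thesis
        by (auto intro: tendsto_eventually)
    next
      case False
      then have "G n (arc_fun c d x) = 0" for n
        by (auto simp: G_def mult_nonneg_nonpos)
      moreover have "x \<notin> {c<..<d}"
        using False arc_fun_pos_iff[OF assms] x by auto
      ultimately show ?thesis by simp
    qed
    moreover have "(\<lambda>n. G n (arc_fun c d x) - \<phi> n x) \<longlonglongrightarrow> 0"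
    proof (rule Lim_null_comparison)
      show "\<forall>\<^sub>F n in sequentially. norm (G n (arc_fun c d x) - \<phi> n x) \<le> 1 / real (Suc n)"
        using close less_imp_le by (auto intro!: always_eventually)
      show "(\<lambda>n. 1 / real (Suc n)) \<longlonglongrightarrow> 0"
        using LIMSEQ_inverse_real_of_nat by (simp add: inverse_eq_divide)
    qed
    ultimately have "(\<lambda>n. G n (arc_fun c d x) - (G n (arc_fun c d x) - \<phi> n x))
        \<longlonglongrightarrow> indicator {c<..<d} x - 0"
      by (rule tendsto_diff)
    then show "(\<lambda>n. \<phi> n x) \<longlonglongrightarrow> indicator {c<..<d} x" by simp
  qed
qed

section \<open>Uniqueness of weak derivatives\<close>

interpretation torus: finite_measure torus
  by (rule finite_measure_lebesgue_on) simp

interpretation torus2: pair_sigma_finite torus torus ..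

lemma continuous_integrable_torus:
  fixes f :: "real \<Rightarrow> real"
  shows "continuous_on UNIV f \<Longrightarrow> integrable torus f"
  by (intro continuous_imp_integrable_real) (auto intro: continuous_on_subset)

lemma trig_poly_continuous: "trig_poly f \<Longrightarrow> continuous_on UNIV f"
  by (intro differentiable_imp_continuous_on trig_poly_deriv)

text \<open>Lebesgue differentiation: off a negligible set, \<open>f x\<close> is the limit of the
  averages of \<open>f\<close> over \<open>[x, x + h]\<close>, and all these averages
  vanish.\<close>

lemma AE_zero_if_integral_cbox_zero:
  fixes f :: "real \<Rightarrow> real"
  assumes int: "\<And>c d. f integrable_on cbox c d" and zero: "\<And>c d. integral (cbox c d) f = 0"
  shows "AE x in lebesgue. f x = 0"
proof -
  obtain N where N: "negligible N"
    "\<And>x e. \<lbrakk>x \<notin> N; 0 < e\<rbrakk> \<Longrightarrow> \<exists>d>0. \<forall>h. 0 < h \<and> h < d \<longrightarrow>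
        norm (integral (cbox x (x + h *\<^sub>R One)) f /\<^sub>R h ^ DIM(real) - f x) < e"
    using integrable_ccontinuous_explicit[OF int] by blast
  have "f x = 0" if "x \<notin> N" for x
  proof (rule ccontr)
    assume "f x \<noteq> 0"
    then obtain \<delta> where "\<delta> > 0" and \<delta>: "\<And>h. 0 < h \<Longrightarrow> h < \<delta> \<Longrightarrow>
        norm (integral (cbox x (x + h *\<^sub>R One)) f /\<^sub>R h ^ DIM(real) - f x) < norm (f x)"
      using N(2)[OF \<open>x \<notin> N\<close>, of "norm (f x)"] by auto
    show False
      using \<delta>[of "\<delta> / 2"] \<open>\<delta> > 0\<close> by (simp only: zero) simp
  qed
  then show ?thesis
    unfolding eventually_ae_filter_negligible using N(1) by blast
qed

text \<open>The fundamental lemma of the calculus of variations on the torus. Orthogonality passes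
  from trigonometric polynomials to indicators of arcs by dominated convergence, so the extension of
  \<open>h\<close> by zero integrates to 0 over every interval.\<close>

lemma AE_zero_if_orthogonal_to_smooth:
  assumes h: "integrable torus h"
    and orth: "\<And>\<phi>. smooth_torus \<phi> \<Longrightarrow> (LINT q|torus. h q * \<phi> q) = 0"
  shows "AE q in torus. h q = 0"
proof -
  have [measurable]: "h \<in> borel_measurable torus" using h by simp
  define f where "f q = (if q \<in> {0..1} then h q else 0)" for q
  have arc: "(LINT q|torus. h q * indicator {c<..<d} q) = 0"
    if cd: "0 \<le> c" "c \<le> d" "d \<le> 1" for c d
  proof -
    obtain \<phi> :: "nat \<Rightarrow> real \<Rightarrow> real" where \<phi>: "\<And>n. trig_poly (\<phi> n)" "\<And>n x. \<bar>\<phi> n x\<bar> \<le> 2"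
      "\<And>x. x \<in> {0..1} \<Longrightarrow> (\<lambda>n. \<phi> n x) \<longlonglongrightarrow> indicator {c<..<d} x"
      using indicator_limit_of_trig_polys[OF cd] by blast
    have [measurable]: "\<phi> n \<in> borel_measurable torus" for n
      using continuous_integrable_torus[OF trig_poly_continuous[OF \<phi>(1)]] by auto
    have "(\<lambda>n. LINT q|torus. h q * \<phi> n q) \<longlonglongrightarrow> (LINT q|torus. h q * indicator {c<..<d} q)"
    proof (rule integral_dominated_convergence)
      show "(\<lambda>q. h q * indicator {c<..<d} q) \<in> borel_measurable torus"
      proof -
        have "indicator {c<..<d} \<in> borel_measurable torus"
          by (intro measurable_restrict_space1 measurable_completion) simp
        then show ?thesis by measurable
      qed
      show "integrable torus (\<lambda>q. 2 * \<bar>h q\<bar>)" using h by simp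
      show "AE q in torus. (\<lambda>n. h q * \<phi> n q) \<longlonglongrightarrow> h q * indicator {c<..<d} q"
        using \<phi>(3) by (auto intro!: AE_I2 tendsto_intros)
      show "AE q in torus. norm (h q * \<phi> n q) \<le> 2 * \<bar>h q\<bar>" for n
        using \<phi>(2)[of n] by (intro AE_I2) (simp add: abs_mult mult.commute mult_left_mono)
    qed measurable
    moreover have "(LINT q|torus. h q * \<phi> n q) = 0" for n
      by (intro orth trig_poly_smooth \<phi>)
    ultimately show ?thesis
      by (simp add: LIMSEQ_const_iff)
  qed
  have hint: "h integrable_on {0..1}"
    by (rule integrable_on_lebesgue_on[OF h]) simp
  have f_int: "f integrable_on cbox c d" for c d
  proof -
    have "f integrable_on UNIV"
      unfolding f_def using hint by (simp only: integrable_restrict_UNIV)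
    then show ?thesis by (rule integrable_on_subcbox) simp
  qed
  have "integral (cbox c d) f = 0" for c d
  proof -
    \<comment> \<open>The interval is clamped to \<open>[0,1]\<close>; the outer
      \<open>max c'\<close> turns an empty intersection into an empty open interval. Open and closed
      versions then differ at most at 0, 1, \<open>c\<close> and \<open>d\<close>.\<close>
    define c' d' where "c' = min 1 (max 0 c)" and "d' = max c' (min 1 d)"
    have cd': "0 \<le> c'" "c' \<le> d'" "d' \<le> 1" by (auto simp: c'_def d'_def)
    have "integrable torus (\<lambda>q. h q * indicator {c'<..<d'} q)"
    proof (rule Bochner_Integration.integrable_bound[OF h])
      have "indicator {c'<..<d'} \<in> borel_measurable torus"
        by (intro measurable_restrict_space1 measurable_completion) simp
      then show "(\<lambda>q. h q * indicator {c'<..<d'} q) \<in> borel_measurable torus" by measurable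
    qed (auto intro!: AE_I2 simp: indicator_def)
    then have "((\<lambda>q. h q * indicator {c'<..<d'} q) has_integral 0) {0..1}"
      using has_integral_integral_lebesgue_on[of "{0..1}" "\<lambda>q. h q * indicator {c'<..<d'} q"] arc[OF cd']
      by simp
    then have "((\<lambda>q. if q \<in> {0..1} then h q * indicator {c'<..<d'} q else 0) has_integral 0) UNIV"
      by (simp only: has_integral_restrict_UNIV)
    then have "((\<lambda>q. if q \<in> cbox c d then f q else 0) has_integral 0) UNIV"
    proof (rule has_integral_spike[rotated 2])
      show "negligible {0, 1, c, d}" by simp
    qed (auto simp: f_def indicator_def c'_def d'_def)
    then show ?thesis
      by (simp only: has_integral_restrict_UNIV integral_unique)
  qed
  then have "AE q in lebesgue. f q = 0"
    by (rule AE_zero_if_integral_cbox_zero[OF f_int])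
  then show ?thesis
    by (auto simp: AE_restrict_space_iff f_def elim!: eventually_mono split: if_splits)
qed

section \<open>Square-integrable functions on the torus\<close>

lemma L2_torusD:
  assumes "f \<in> L2_torus"
  shows "f \<in> borel_measurable torus" "integrable torus (\<lambda>q. (f q)\<^sup>2)"
  using assms by (auto simp: L2_torus_def)

lemma L2_torus_integrable_mult:
  assumes f: "f \<in> borel_measurable torus" "integrable torus (\<lambda>q. (f q)\<^sup>2)"
    and g: "g \<in> borel_measurable torus" "integrable torus (\<lambda>q. (g q)\<^sup>2)"
  shows "integrable torus (\<lambda>q. f q * g q :: real)"
proof (rule Bochner_Integration.integrable_bound)
  show "integrable torus (\<lambda>q. (f q)\<^sup>2 + (g q)\<^sup>2)" using f g by simp
  show "(\<lambda>q. f q * g q) \<in> borel_measurable torus" using f g by simp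
  have "\<bar>x * y\<bar> \<le> x\<^sup>2 + y\<^sup>2" for x y :: real
  proof -
    have "0 \<le> (\<bar>x\<bar> - \<bar>y\<bar>)\<^sup>2" "0 \<le> \<bar>x\<bar> * \<bar>y\<bar>" by auto
    moreover have "(\<bar>x\<bar> - \<bar>y\<bar>)\<^sup>2 = x\<^sup>2 + y\<^sup>2 - 2 * (\<bar>x\<bar> * \<bar>y\<bar>)"
      by (simp add: power2_diff)
    ultimately show ?thesis unfolding abs_mult by linarith
  qed
  then show "AE q in torus. norm (f q * g q) \<le> norm ((f q)\<^sup>2 + (g q)\<^sup>2)"
    by (auto intro!: AE_I2)
qed

lemma L2_torus_integrable:
  assumes "f \<in> L2_torus"
  shows "integrable torus f"
  using L2_torus_integrable_mult[OF L2_torusD[OF assms], of "\<lambda>_. 1"] by simp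

lemma integrable_bounded_mult_torus:
  fixes A f :: "real \<Rightarrow> real"
  assumes "A \<in> borel_measurable torus" "AE q in torus. \<bar>A q\<bar> \<le> K" "integrable torus f"
  shows "integrable torus (\<lambda>q. A q * f q)"
proof (rule Bochner_Integration.integrable_bound)
  show "integrable torus (\<lambda>q. K * \<bar>f q\<bar>)" using assms by simp
  show "(\<lambda>q. A q * f q) \<in> borel_measurable torus" using assms by simp
  show "AE q in torus. norm (A q * f q) \<le> norm (K * \<bar>f q\<bar>)"
    using assms(2)
  proof eventually_elim
    case (elim q)
    then have "\<bar>A q\<bar> * \<bar>f q\<bar> \<le> \<bar>K\<bar> * \<bar>f q\<bar>" by (intro mult_right_mono) auto
    then show ?case by (simp add: abs_mult)
  qed
qed

lemma smooth_torusD: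
  assumes "smooth_torus \<phi>"
  shows "\<phi> (x + 1) = \<phi> x" "(\<phi> has_real_derivative deriv \<phi> x) (at x)"
    "continuous_on UNIV \<phi>" "continuous_on UNIV (deriv \<phi>)"
proof -
  have diff: "(deriv ^^ n) \<phi> differentiable_on UNIV" for n
    using assms by (auto simp: smooth_torus_def)
  show "\<phi> (x + 1) = \<phi> x"
    using assms by (auto simp: smooth_torus_def periodic_fun_simple'_def)
  have d0: "\<phi> differentiable_on UNIV" using diff[of 0] by simp
  then show "(\<phi> has_real_derivative deriv \<phi> x) (at x)"
    by (simp add: differentiable_on_def DERIV_deriv_iff_real_differentiable)
  show "continuous_on UNIV \<phi>"
    using d0 by (rule differentiable_imp_continuous_on)
  show "continuous_on UNIV (deriv \<phi>)"
    using diff[of 1] by (auto intro: differentiable_imp_continuous_on)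
qed

lemma L2_torus_integrable_mult_continuous:
  assumes "f \<in> L2_torus" "continuous_on UNIV \<phi>"
  shows "integrable torus (\<lambda>q. f q * \<phi> q)"
proof (rule L2_torus_integrable_mult[OF L2_torusD[OF assms(1)]])
  show "\<phi> \<in> borel_measurable torus"
    using continuous_integrable_torus[OF assms(2)] by auto
  show "integrable torus (\<lambda>q. (\<phi> q)\<^sup>2)"
    by (intro continuous_integrable_torus continuous_intros assms)
qed

text \<open>The difference of two weak derivatives is orthogonal to every test function. Thus an
  explicitly constructed weak derivative agrees almost everywhere with the one picked by
  \<open>weak_deriv\<close>.\<close>

lemma weak_deriv_unique:
  assumes "has_weak_deriv u g1" "has_weak_deriv u g2" "g1 \<in> L2_torus" "g2 \<in> L2_torus"
  shows "AE q in torus. g1 q = g2 q"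
proof -
  have "AE q in torus. g1 q - g2 q = 0"
  proof (rule AE_zero_if_orthogonal_to_smooth)
    show "integrable torus (\<lambda>q. g1 q - g2 q)"
      using L2_torus_integrable assms by simp
    fix \<phi> assume \<phi>: "smooth_torus \<phi>"
    have "(LINT q|torus. (g1 q - g2 q) * \<phi> q)
        = (LINT q|torus. g1 q * \<phi> q) - (LINT q|torus. g2 q * \<phi> q)"
      unfolding left_diff_distrib
      by (intro Bochner_Integration.integral_diff L2_torus_integrable_mult_continuous
          assms smooth_torusD[OF \<phi>])
    also have "\<dots> = 0"
      using assms(1,2) \<phi> by (auto simp: has_weak_deriv_def)
    finally show "(LINT q|torus. (g1 q - g2 q) * \<phi> q) = 0" .
  qed
  then show ?thesis by simp
qed

lemma weak_deriv_H1_torus: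
  assumes "u \<in> H1_torus"
  shows "weak_deriv u \<in> L2_torus" "has_weak_deriv u (weak_deriv u)"
proof -
  have "\<exists>g. g \<in> L2_torus \<and> has_weak_deriv u g"
    using assms by (auto simp: H1_torus_def)
  then have "weak_deriv u \<in> L2_torus \<and> has_weak_deriv u (weak_deriv u)"
    unfolding weak_deriv_def by (rule someI_ex)
  then show "weak_deriv u \<in> L2_torus" "has_weak_deriv u (weak_deriv u)" by auto
qed

text \<open>Test against the constant 1, whose derivative is 0. This is what makes a constant flux
  solve the corrector equation.\<close>

lemma integral_weak_deriv:
  assumes "u \<in> H1_torus"
  shows "(LINT q|torus. weak_deriv u q) = 0"
proof -
  have "smooth_torus (\<lambda>_. 1)"
    by (intro trig_poly_smooth trig_poly.const)
  then have "(LINT q|torus. u q * deriv (\<lambda>_. 1) q) = - (LINT q|torus. weak_deriv u q * 1)"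
    using weak_deriv_H1_torus[OF assms] unfolding has_weak_deriv_def by blast
  then show ?thesis by simp
qed

section \<open>Existence of correctors\<close>

text \<open>The fundamental theorem of calculus on \<open>[y,1]\<close>, in the form of the inner
  integral met after Fubini in the next construction.\<close>

lemma integral_deriv_tail:
  assumes "smooth_torus \<phi>" "y \<in> {0..1}"
  shows "(LINT x|torus. indicator {y..} x * deriv \<phi> x) = \<phi> 1 - \<phi> y"
proof -
  have int: "integrable torus (\<lambda>x. indicator {y..} x * deriv \<phi> x)"
  proof (rule integrable_bounded_mult_torus)
    show "indicator {y..} \<in> borel_measurable torus"
      by (intro measurable_restrict_space1 measurable_completion) simp
    show "AE q in torus. \<bar>indicator {y..} q\<bar> \<le> (1::real)" by (auto simp: indicator_def)
    show "integrable torus (deriv \<phi>)"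
      by (intro continuous_integrable_torus smooth_torusD[OF assms(1)])
  qed
  have "(deriv \<phi> has_integral \<phi> 1 - \<phi> y) {y..1}"
    using smooth_torusD[OF assms(1)] assms(2)
    by (intro fundamental_theorem_of_calculus)
       (auto intro: has_field_derivative_at_within has_real_derivative_iff_has_vector_derivative[THEN iffD1])
  then have "((\<lambda>x. if x \<in> {y..1} then deriv \<phi> x else 0) has_integral \<phi> 1 - \<phi> y) UNIV"
    by (simp only: has_integral_restrict_UNIV)
  also have "(\<lambda>x. if x \<in> {y..1} then deriv \<phi> x else 0)
      = (\<lambda>x. if x \<in> {0..1} then indicator {y..} x * deriv \<phi> x else 0)"
    using assms(2) by (auto simp: indicator_def)
  finally have "((\<lambda>x. indicator {y..} x * deriv \<phi> x) has_integral \<phi> 1 - \<phi> y) {0..1}"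
    by (simp only: has_integral_restrict_UNIV)
  moreover have "((\<lambda>x. indicator {y..} x * deriv \<phi> x) has_integral
      (LINT x|torus. indicator {y..} x * deriv \<phi> x)) {0..1}"
    by (rule has_integral_integral_lebesgue_on[OF int]) simp
  ultimately show ?thesis by (rule has_integral_unique[symmetric])
qed

lemma torus_id_measurable [measurable]: "(\<lambda>x. x) \<in> borel_measurable torus"
  using id_borel_measurable_lebesgue_on[of "{0..1}"] by (simp add: id_def)

text \<open>
  The antiderivative \<open>W\<close> is extended periodically from \<open>[0,1[\<close>; this is consistent at \<open>1\<close>
  because \<open>g\<close> has mean zero.
\<close>

lemma ex_zero_mean_antiderivative:
  assumes g: "g \<in> L2_torus" and mean: "(LINT q|torus. g q) = 0"
  obtains w where "w \<in> H1_torus" "(LINT q|torus. w q) = 0" "has_weak_deriv w g"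
proof -
  have gi: "integrable torus g" by (rule L2_torus_integrable[OF g])
  have [measurable]: "g \<in> borel_measurable torus" using gi by simp
  define W where "W x = (LINT y|torus. indicator {..x} y * g y)" for x
  define C where "C = (LINT x|torus. W x)"
  define w where "w x = W (frac x) - C" for x
  \<comment> \<open>This form of the kernel displays its dependence on both variables, as
    measurability in \<open>x\<close> and Fubini require.\<close>
  have W_eq: "W x = (LINT y|torus. of_bool (y \<le> x) * g y)" for x
    unfolding W_def by (intro Bochner_Integration.integral_cong) (auto simp: indicator_def)
  have W_meas [measurable]: "W \<in> borel_measurable torus"
    unfolding W_eq[abs_def] by measurable
  have slice: "integrable torus (\<lambda>y. of_bool (y \<le> x) * g y)" for x
  proof (rule integrable_bounded_mult_torus[OF _ _ gi])
    have "(\<lambda>y. of_bool (y \<le> x) :: real) \<in> borel_measurable borel" by measurable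
    then show "(\<lambda>y. of_bool (y \<le> x) :: real) \<in> borel_measurable torus"
      by (intro measurable_restrict_space1 measurable_completion) simp
    show "AE y in torus. \<bar>of_bool (y \<le> x)\<bar> \<le> (1::real)" by simp
  qed
  have W_bound: "\<bar>W x\<bar> \<le> (LINT y|torus. \<bar>g y\<bar>)" for x
  proof -
    have "\<bar>W x\<bar> \<le> (LINT y|torus. \<bar>of_bool (y \<le> x) * g y\<bar>)"
      unfolding W_eq using integral_norm_bound[of torus "\<lambda>y. of_bool (y \<le> x) * g y"] by simp
    also have "\<dots> \<le> (LINT y|torus. \<bar>g y\<bar>)"
      using slice[of x] gi by (intro integral_mono) auto
    finally show ?thesis .
  qed
  have W_int: "integrable torus W"
    using W_bound by (intro torus.integrable_const_bound) auto
  have W0: "W 0 = 0"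
    unfolding W_def
  proof (rule integral_eq_zero_AE)
    have "AE y in lebesgue. y \<noteq> (0::real)"
      unfolding eventually_ae_filter_negligible by (intro exI[of _ "{0}"]) auto
    then show "AE y in torus. indicator {..0} y * g y = 0"
      by (auto simp: AE_restrict_space_iff indicator_def elim!: eventually_mono)
  qed
  have W1: "W 1 = 0"
  proof -
    have "W 1 = (LINT y|torus. g y)"
      unfolding W_def by (intro Bochner_Integration.integral_cong) (auto simp: indicator_def)
    then show ?thesis using mean by simp
  qed
  \<comment> \<open>At the endpoint 1 the fractional part is 0, and the two values match because
    \<open>W 0 = W 1 = 0\<close>.\<close>
  have w_eq: "w x = W x - C" if "x \<in> space torus" for x
  proof (cases "x = 1")
    case False
    then have "frac x = x" using that by (simp add: frac_eq)
    then show ?thesis by (simp add: w_def)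
  qed (simp add: w_def W0 W1)
  have w_meas: "w \<in> borel_measurable torus"
    using measurable_cong[of torus w "\<lambda>x. W x - C", OF w_eq] by simp
  have w_L2: "w \<in> L2_torus"
  proof -
    have "\<bar>w x\<bar> \<le> (LINT y|torus. \<bar>g y\<bar>) + \<bar>C\<bar>" for x
      using W_bound[of "frac x"] unfolding w_def by linarith
    then have "(w x)\<^sup>2 \<le> ((LINT y|torus. \<bar>g y\<bar>) + \<bar>C\<bar>)\<^sup>2" for x
      by (metis abs_ge_zero power2_abs power_mono)
    then have "integrable torus (\<lambda>q. (w q)\<^sup>2)"
      using w_meas by (intro torus.integrable_const_bound) auto
    moreover have "frac (x + 1) = frac x" for x :: real
      by (simp add: frac_def)
    ultimately show ?thesis
      using w_meas by (auto simp: L2_torus_def periodic_fun_simple'_def w_def)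
  qed
  have w_mean: "(LINT q|torus. w q) = 0"
  proof -
    have "(LINT q|torus. w q) = (LINT q|torus. W q - C)"
      by (intro Bochner_Integration.integral_cong w_eq) auto
    also have "\<dots> = C - C * measure torus (space torus)"
      using W_int by (simp add: C_def)
    finally show ?thesis by (simp add: measure_restrict_space)
  qed
  have "has_weak_deriv w g"
    unfolding has_weak_deriv_def
  proof (intro allI impI)
    fix \<phi> assume \<phi>: "smooth_torus \<phi>"
    have d\<phi>: "integrable torus (deriv \<phi>)"
      by (intro continuous_integrable_torus smooth_torusD[OF \<phi>])
    then have [measurable]: "deriv \<phi> \<in> borel_measurable torus" by simp
    have Wd: "integrable torus (\<lambda>x. W x * deriv \<phi> x)"
      by (rule integrable_bounded_mult_torus[OF W_meas _ d\<phi>]) (use W_bound in auto)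
    have per: "\<phi> 1 = \<phi> 0" using smooth_torusD(1)[OF \<phi>, of 0] by simp
    \<comment> \<open>By periodicity of \<open>\<phi>\<close>; it removes the constant
      \<open>C\<close> at the end.\<close>
    have dmean: "(LINT x|torus. deriv \<phi> x) = 0"
    proof -
      have "(LINT x|torus. deriv \<phi> x) = (LINT x|torus. indicator {0..} x * deriv \<phi> x)"
        by (intro Bochner_Integration.integral_cong) (auto simp: indicator_def)
      then show ?thesis using integral_deriv_tail[OF \<phi>, of 0] per by simp
    qed
    \<comment> \<open>Absolute integrability for Fubini: the inner integral is at most the
      \<open>L^1\<close> norm of \<open>g\<close>, and \<open>deriv \<phi>\<close> is
      integrable.\<close>
    have pair: "integrable (torus \<Otimes>\<^sub>M torus)
        (\<lambda>(x, y). of_bool (y \<le> x) * g y * deriv \<phi> x)"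
    proof (rule torus2.Fubini_integrable)
      have "integrable torus (\<lambda>x. (LINT y|torus. \<bar>of_bool (y \<le> x) * g y\<bar>) * \<bar>deriv \<phi> x\<bar>)"
      proof (rule integrable_bounded_mult_torus)
        show "AE x in torus. \<bar>LINT y|torus. \<bar>of_bool (y \<le> x) * g y\<bar>\<bar> \<le> (LINT y|torus. \<bar>g y\<bar>)"
        proof (intro AE_I2)
          fix x :: real
          have "(LINT y|torus. \<bar>of_bool (y \<le> x) * g y\<bar>) \<le> (LINT y|torus. \<bar>g y\<bar>)"
            using slice[of x] gi by (intro integral_mono) auto
          then show "\<bar>LINT y|torus. \<bar>of_bool (y \<le> x) * g y\<bar>\<bar> \<le> (LINT y|torus. \<bar>g y\<bar>)"
            by simp
        qed
        show "integrable torus (\<lambda>x. \<bar>deriv \<phi> x\<bar>)" using d\<phi> by simp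
      qed measurable
      then show "integrable torus (\<lambda>x. LINT y|torus.
          norm (case (x, y) of (x, y) \<Rightarrow> of_bool (y \<le> x) * g y * deriv \<phi> x))"
        by (simp add: abs_mult)
      show "AE x in torus. integrable torus
          (\<lambda>y. case (x, y) of (x, y) \<Rightarrow> of_bool (y \<le> x) * g y * deriv \<phi> x)"
        using slice by (auto intro!: AE_I2)
    qed measurable
    \<comment> \<open>Integration by parts through Fubini: exchanging the order turns the integral
      defining \<open>W\<close> into a tail integral of \<open>deriv \<phi>\<close>. The boundary
      term \<open>\<phi> 1 * g y\<close> then vanishes by the zero mean of \<open>g\<close>.\<close>
    have "(LINT x|torus. W x * deriv \<phi> x)
        = (LINT x|torus. LINT y|torus. of_bool (y \<le> x) * g y * deriv \<phi> x)"
      unfolding W_eq by simp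
    also have "\<dots> = (LINT y|torus. LINT x|torus. of_bool (y \<le> x) * g y * deriv \<phi> x)"
      by (rule torus2.Fubini_integral[OF pair, symmetric])
    also have "\<dots> = (LINT y|torus. \<phi> 1 * g y - g y * \<phi> y)"
    proof (rule Bochner_Integration.integral_cong)
      fix y assume "y \<in> space torus"
      then have y: "y \<in> {0..1}" by simp
      have "(LINT x|torus. of_bool (y \<le> x) * g y * deriv \<phi> x)
          = (LINT x|torus. g y * (indicator {y..} x * deriv \<phi> x))"
        by (intro Bochner_Integration.integral_cong) (auto simp: indicator_def)
      also have "\<dots> = g y * (\<phi> 1 - \<phi> y)"
        using integral_deriv_tail[OF \<phi> y] by simp
      finally show "(LINT x|torus. of_bool (y \<le> x) * g y * deriv \<phi> x) = \<phi> 1 * g y - g y * \<phi> y"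
        by (simp add: algebra_simps)
    qed simp
    also have "\<dots> = - (LINT y|torus. g y * \<phi> y)"
      using gi mean L2_torus_integrable_mult_continuous[OF g smooth_torusD(3)[OF \<phi>]] by simp
    finally have main: "(LINT x|torus. W x * deriv \<phi> x) = - (LINT y|torus. g y * \<phi> y)" .
    have "(LINT q|torus. w q * deriv \<phi> q) = (LINT q|torus. W q * deriv \<phi> q - C * deriv \<phi> q)"
      by (intro Bochner_Integration.integral_cong) (simp_all add: w_eq left_diff_distrib)
    also have "\<dots> = - (LINT q|torus. g q * \<phi> q)"
      using Wd d\<phi> dmean main by simp
    finally show "(LINT q|torus. w q * deriv \<phi> q) = - (LINT q|torus. g q * \<phi> q)" .
  qed
  with w_L2 g w_mean that show thesis by (auto simp: H1_torus_def)
qed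

section \<open>Uniformly elliptic coefficients, their correctors and homogenized
  coefficients\<close>

locale elliptic_coefficient =
  fixes A :: "real \<Rightarrow> real" and \<alpha> \<beta> :: real
  assumes periodic: "A (x + 1) = A x"
    and measurable_torus [measurable]: "A \<in> borel_measurable torus"
    and \<alpha>_pos: "0 < \<alpha>"
    and bounds: "AE q in torus. \<alpha> \<le> A q \<and> A q \<le> \<beta>"
begin

lemma abs_bound: "AE q in torus. \<bar>A q\<bar> \<le> \<beta>"
  using bounds by eventually_elim (use \<alpha>_pos in auto)

text \<open>In one dimension the flux \<open>A (1 + w')\<close> is constant, so it is the harmonic mean of \<open>A\<close>.\<close>

lemma ex_corrector: "\<exists>w. is_corrector A w"
proof -
  define I where "I = (LINT q|torus. inverse (A q))"
  have inv_bound: "AE q in torus. inverse \<beta> \<le> inverse (A q) \<and> \<bar>inverse (A q)\<bar> \<le> inverse \<alpha>"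
    using bounds
  proof eventually_elim
    case (elim q)
    then show ?case
      using \<alpha>_pos le_imp_inverse_le[of \<alpha> "A q"] le_imp_inverse_le[of "A q" \<beta>] by auto
  qed
  have inv_int: "integrable torus (\<lambda>q. inverse (A q))"
    using inv_bound by (intro torus.integrable_const_bound[of _ "inverse \<alpha>"]) auto
  have measure_torus: "measure torus (space torus) = 1"
    by (simp add: measure_restrict_space)
  \<comment> \<open>The bounds hold at some point because the torus is not a null set; hence
    \<open>\<beta> > 0\<close>, which gives \<open>I > 0\<close> below.\<close>
  have "AE q in torus. \<alpha> \<le> \<beta>" using bounds by eventually_elim auto
  moreover have "\<not> (AE q in torus. False)"
    by (simp add: ae_filter_eq_bot_iff eventually_False emeasure_restrict_space)
  ultimately have "\<alpha> \<le> \<beta>" by (cases "\<alpha> \<le> \<beta>") auto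
  have "inverse \<beta> = (LINT q|torus. inverse \<beta>)" using measure_torus by simp
  also have "\<dots> \<le> I"
    unfolding I_def using inv_bound inv_int by (intro integral_mono_AE) auto
  finally have "0 < I" using \<alpha>_pos \<open>\<alpha> \<le> \<beta>\<close> by (smt (verit) positive_imp_inverse_positive)
  \<comment> \<open>Obtained by solving \<open>A * (1 + g) = inverse I\<close> for \<open>g\<close>;
    the value \<open>inverse I\<close> of the flux is the one for which \<open>g\<close> has mean
    zero.\<close>
  define g where "g q = inverse I * inverse (A q) - 1" for q
  have g_meas: "g \<in> borel_measurable torus" unfolding g_def by measurable
  have "AE q in torus. norm ((g q)\<^sup>2) \<le> (inverse I * inverse \<alpha> + 1)\<^sup>2"
    using inv_bound
  proof eventually_elim
    case (elim q)
    have "\<bar>g q\<bar> \<le> inverse I * \<bar>inverse (A q)\<bar> + 1"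
      unfolding g_def using \<open>0 < I\<close> abs_triangle_ineq4[of "inverse I * inverse (A q)" 1]
      by (simp add: abs_mult)
    also have "\<dots> \<le> inverse I * inverse \<alpha> + 1"
      using elim \<open>0 < I\<close> by (intro add_right_mono mult_left_mono) auto
    finally have "\<bar>g q\<bar>\<^sup>2 \<le> (inverse I * inverse \<alpha> + 1)\<^sup>2" by (intro power_mono) auto
    then show ?case by simp
  qed
  then have "integrable torus (\<lambda>q. (g q)\<^sup>2)"
    using g_meas by (intro torus.integrable_const_bound) auto
  then have g_L2: "g \<in> L2_torus"
    using g_meas periodic by (auto simp: L2_torus_def periodic_fun_simple'_def g_def)
  have "(LINT q|torus. g q) = 0"
    unfolding g_def using inv_int measure_torus \<open>0 < I\<close> by (simp flip: I_def)
  then obtain w where w: "w \<in> H1_torus" "(LINT q|torus. w q) = 0" "has_weak_deriv w g"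
    using ex_zero_mean_antiderivative[OF g_L2] by blast
  have "AE q in torus. weak_deriv w q = g q"
    using weak_deriv_unique weak_deriv_H1_torus[OF w(1)] w(3) g_L2 by blast
  then have flux: "AE q in torus. A q * (1 + weak_deriv w q) = inverse I"
    using bounds by eventually_elim (use \<alpha>_pos in \<open>auto simp: g_def\<close>)
  have "(LINT q|torus. A q * (1 + weak_deriv w q) * weak_deriv \<phi> q) = 0"
    if \<phi>: "\<phi> \<in> H1_torus" for \<phi>
  proof -
    have [measurable]: "weak_deriv w \<in> borel_measurable torus" "weak_deriv \<phi> \<in> borel_measurable torus"
      using weak_deriv_H1_torus(1)[OF w(1)] weak_deriv_H1_torus(1)[OF \<phi>] L2_torusD by auto
    have "(LINT q|torus. A q * (1 + weak_deriv w q) * weak_deriv \<phi> q)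
        = (LINT q|torus. inverse I * weak_deriv \<phi> q)"
      using flux by (intro integral_cong_AE) (measurable, auto elim!: eventually_mono)
    then show ?thesis using integral_weak_deriv[OF \<phi>] by simp
  qed
  with w show ?thesis by (auto simp: is_corrector_def)
qed

text \<open>
  Testing the corrector equation against the corrector itself gives
  \<open>\<integral> A (1 + w')\<^sup>2 = \<integral> A - \<integral> A w'\<^sup>2\<close>.
\<close>

lemma A_hom_energy:
  obtains g where "(LINT q|torus. g q) = 0"
    "(LINT q|torus. A q * g q) = - (LINT q|torus. A q * (g q)\<^sup>2)"
    "A_hom A = (LINT q|torus. A q) - (LINT q|torus. A q * (g q)\<^sup>2)"
proof -
  define w where "w = corrector A"
  have w: "is_corrector A w"
    unfolding w_def corrector_def by (rule someI_ex[OF ex_corrector])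
  then have w_H1: "w \<in> H1_torus" by (simp add: is_corrector_def)
  define g where "g = weak_deriv w"
  have g: "g \<in> L2_torus" unfolding g_def by (rule weak_deriv_H1_torus[OF w_H1])
  have A_int: "integrable torus A"
    using abs_bound by (intro torus.integrable_const_bound) auto
  have Ag: "integrable torus (\<lambda>q. A q * g q)"
    by (rule integrable_bounded_mult_torus[OF measurable_torus abs_bound L2_torus_integrable[OF g]])
  have Agg: "integrable torus (\<lambda>q. A q * (g q)\<^sup>2)"
    by (rule integrable_bounded_mult_torus[OF measurable_torus abs_bound L2_torusD(2)[OF g]])
  have "(LINT q|torus. A q * (1 + g q) * g q) = 0"
    using w w_H1 unfolding is_corrector_def g_def by blast
  moreover have "(LINT q|torus. A q * (1 + g q) * g q)
      = (LINT q|torus. A q * g q) + (LINT q|torus. A q * (g q)\<^sup>2)"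
    using Ag Agg by (simp add: algebra_simps power2_eq_square)
  ultimately have orth: "(LINT q|torus. A q * g q) = - (LINT q|torus. A q * (g q)\<^sup>2)" by simp
  have "A_hom A = (LINT q|torus. A q + 2 * (A q * g q) + A q * (g q)\<^sup>2)"
    unfolding A_hom_def w_def[symmetric] g_def[symmetric]
    by (intro Bochner_Integration.integral_cong) (auto simp: power2_eq_square algebra_simps)
  also have "\<dots> = (LINT q|torus. A q) + 2 * (LINT q|torus. A q * g q) + (LINT q|torus. A q * (g q)\<^sup>2)"
    using A_int Ag Agg by simp
  finally have "A_hom A = (LINT q|torus. A q) - (LINT q|torus. A q * (g q)\<^sup>2)"
    using orth by simp
  moreover have "(LINT q|torus. g q) = 0"
    unfolding g_def by (rule integral_weak_deriv[OF w_H1])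
  ultimately show thesis using that orth by blast
qed

text \<open>Used to bound the Rayleigh quotients from below when two infima are compared.\<close>

lemma A_hom_nonneg: "0 \<le> A_hom A"
  unfolding A_hom_def
  using bounds \<alpha>_pos by (intro integral_nonneg_AE) (force elim!: eventually_mono)

lemma A_hom_le_mean: "A_hom A \<le> (LINT q|torus. A q)"
proof -
  obtain g where "A_hom A = (LINT q|torus. A q) - (LINT q|torus. A q * (g q)\<^sup>2)"
    using A_hom_energy by blast
  moreover have "0 \<le> (LINT q|torus. A q * (g q)\<^sup>2)"
    using bounds \<alpha>_pos by (intro integral_nonneg_AE) (force elim!: eventually_mono)
  ultimately show ?thesis by simp
qed

text \<open>The torus has measure 1, so the pointwise bound
  \<open>A \<le> A^p / p + (1 - 1/p)\<close> integrates to at most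
  \<open>1/p + (1 - 1/p)\<close>.\<close>

lemma mean_le_one:
  assumes "1 \<le> p" "(LINT q|torus. A q powr p) \<le> 1"
  shows "(LINT q|torus. A q) \<le> 1"
proof -
  have A_int: "integrable torus A"
    using abs_bound by (intro torus.integrable_const_bound) auto
  have "AE q in torus. norm (A q powr p) \<le> \<beta> powr p"
    using bounds by eventually_elim (use \<alpha>_pos assms(1) in \<open>auto intro!: powr_mono2\<close>)
  then have Ap_int: "integrable torus (\<lambda>q. A q powr p)"
    by (intro torus.integrable_const_bound) auto
  have "AE q in torus. A q \<le> (1 / p) * A q powr p + (1 - 1 / p)"
    using bounds
  proof eventually_elim
    case (elim q)
    \<comment> \<open>Weighted Young inequality for the numbers \<open>A q powr p\<close> and 1 with
      weights \<open>1/p\<close> and \<open>1 - 1/p\<close>; the second weight may be 0, which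
      covers \<open>p = 1\<close>.\<close>
    then have "(A q powr p) powr (1 / p) * 1 powr (1 - 1 / p) \<le> 1 / p * A q powr p + (1 - 1 / p) * 1"
      using assms(1) \<alpha>_pos by (intro Youngs_inequality_0) auto
    then show ?case using elim assms(1) \<alpha>_pos by (simp add: powr_powr)
  qed
  then have "(LINT q|torus. A q) \<le> (LINT q|torus. (1 / p) * A q powr p + (1 - 1 / p))"
    using A_int Ap_int by (intro integral_mono_AE) auto
  also have "\<dots> = (1 / p) * (LINT q|torus. A q powr p) + (1 - 1 / p)"
    using Ap_int by (simp add: measure_restrict_space)
  also have "\<dots> \<le> (1 / p) * 1 + (1 - 1 / p)"
    using assms by (intro add_right_mono mult_left_mono) auto
  finally show ?thesis by simp
qed

end

text \<open>For \<open>A = 1\<close> the energy identity says that the integral of \<open>g\<close>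
  is minus that of its square. The former is 0, so the energy lost is 0.\<close>

lemma A_hom_one: "A_hom (\<lambda>_. 1) = 1"
proof -
  interpret elliptic_coefficient "\<lambda>_. 1" 1 1
    by unfold_locales auto
  obtain g where "(LINT q|torus. g q) = 0"
    "(LINT q|torus. 1 * g q) = - (LINT q|torus. 1 * (g q)\<^sup>2)"
    "A_hom (\<lambda>_. 1) = (LINT q|torus. 1) - (LINT q|torus. 1 * (g q)\<^sup>2)"
    using A_hom_energy by metis
  then show ?thesis by (simp add: measure_restrict_space)
qed

section \<open>The variational problem\<close>

text \<open>The class of competitors does not depend on the diffusion, and each Rayleigh quotient is
  monotone in the homogenized coefficient. Nonnegativity supplies the lower bound needed to compare
  real infima.\<close>

lemma Lambda_hom_mono:
  assumes "0 \<le> D_hom V D" "D_hom V D \<le> D_hom V D'"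
  shows "Lambda_hom V D \<le> Lambda_hom V D'"
proof (cases "{u \<in> H10_torus. \<not> (AE q in torus. u q = 0)} = {}")
  \<comment> \<open>Both sides are then the same infimum of the empty set.\<close>
  case True
  show ?thesis by (simp add: Lambda_hom_def True)
next
  case False
  show ?thesis
    unfolding Lambda_hom_def
  proof (rule cINF_mono[OF False])
    show "bdd_below ((\<lambda>u. (LINT q|torus. D_hom V D * (weak_deriv u q)\<^sup>2) / (LINT q|torus. (u q)\<^sup>2))
        ` {u \<in> H10_torus. \<not> (AE q in torus. u q = 0)})"
      by (rule bdd_belowI2[of _ 0]) (use assms(1) in simp)
    fix u assume u: "u \<in> {u \<in> H10_torus. \<not> (AE q in torus. u q = 0)}"
    have "D_hom V D * (LINT q|torus. (weak_deriv u q)\<^sup>2)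
        \<le> D_hom V D' * (LINT q|torus. (weak_deriv u q)\<^sup>2)"
      by (intro mult_right_mono assms) simp
    then have "(LINT q|torus. D_hom V D * (weak_deriv u q)\<^sup>2) / (LINT q|torus. (u q)\<^sup>2)
      \<le> (LINT q|torus. D_hom V D' * (weak_deriv u q)\<^sup>2) / (LINT q|torus. (u q)\<^sup>2)"
      by (simp add: divide_right_mono)
    with u show "\<exists>v \<in> {u \<in> H10_torus. \<not> (AE q in torus. u q = 0)}.
        (LINT q|torus. D_hom V D * (weak_deriv v q)\<^sup>2) / (LINT q|torus. (v q)\<^sup>2)
      \<le> (LINT q|torus. D_hom V D' * (weak_deriv u q)\<^sup>2) / (LINT q|torus. (u q)\<^sup>2)"
      by blast
  qed
qed

section \<open>Admissible diffusions and the maximizer\<close>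

lemma smooth_torus_borel_measurable: "smooth_torus V \<Longrightarrow> V \<in> borel_measurable borel"
  by (intro borel_measurable_continuous_onI smooth_torusD)

lemma diffusion_set_elliptic:
  assumes V: "smooth_torus V" and "0 < a" and D: "D \<in> diffusion_set V p a b"
  shows "elliptic_coefficient (weighted_diffusion V D) a (inverse b)"
proof
  show "weighted_diffusion V D (x + 1) = weighted_diffusion V D x" for x
    using D smooth_torusD(1)[OF V]
    by (auto simp: weighted_diffusion_def diffusion_set_def periodic_fun_simple'_def)
  have "D \<in> borel_measurable torus"
    using D by (auto simp: diffusion_set_def intro: measurable_restrict_space1)
  moreover have "V \<in> borel_measurable torus"
    using smooth_torus_borel_measurable[OF V]
    by (intro measurable_restrict_space1 measurable_completion) simp
  ultimately show "weighted_diffusion V D \<in> borel_measurable torus"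
    unfolding weighted_diffusion_def[abs_def] by measurable
qed (use assms in \<open>auto simp: weighted_diffusion_def diffusion_set_def\<close>)

text \<open>The weight in the normalization is such that its integrand is the \<open>p\<close>-th
  power of the weighted diffusion, so the bounds by the mean and on the mean chain together.\<close>

lemma A_hom_le_one:
  assumes V: "smooth_torus V" and "0 < a" "1 \<le> p" and D: "D \<in> diffusion_set V p a b"
  shows "A_hom (weighted_diffusion V D) \<le> 1"
proof -
  interpret elliptic_coefficient "weighted_diffusion V D" a "inverse b"
    by (rule diffusion_set_elliptic[OF V \<open>0 < a\<close> D])
  have "weighted_diffusion V D q powr p = D q powr p * exp (- p * V q)" for q
    using D by (auto simp: weighted_diffusion_def diffusion_set_def powr_mult exp_powr_real
        mult.commute)
  then have "(LINT q|torus. weighted_diffusion V D q powr p) \<le> 1"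
    using D by (simp add: diffusion_set_def)
  with \<open>1 \<le> p\<close> A_hom_le_mean show ?thesis using mean_le_one by fastforce
qed

text \<open>The weighted diffusion is identically 1: the pointwise bounds become
  \<open>a \<le> 1 \<le> inverse b\<close>, and the normalization integral is the measure of the
  torus.\<close>

lemma exp_in_diffusion_set:
  assumes V: "smooth_torus V" and "a \<le> 1" "1 \<le> inverse b"
  shows "(\<lambda>q. exp (V q)) \<in> diffusion_set V p a b"
proof -
  have "V \<in> borel_measurable lebesgue"
    using smooth_torus_borel_measurable[OF V] by (intro measurable_completion) simp
  moreover have "exp (V q) powr p * exp (- (p * V q)) = 1" for q
    by (simp add: exp_powr_real mult.commute flip: exp_add)
  ultimately show ?thesis
    using assms smooth_torusD(1)[OF V]
    by (auto simp: diffusion_set_def periodic_fun_simple'_def measure_restrict_space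
        simp flip: exp_add)
qed

text \<open>Boundedness from above is part of the claim because the supremum of an unbounded set of
  reals would carry no meaning.\<close>

theorem proposition11:
  fixes V :: "real \<Rightarrow> real" and p a b :: real
  assumes "smooth_torus V"
    and "1 \<le> p"
    and "0 < a" and "a \<le> 1" and "0 < b" and "1 \<le> inverse b"
  shows "(\<lambda>q. exp (V q)) \<in> diffusion_set V p a b \<and>
         bdd_above (Lambda_hom V ` diffusion_set V p a b) \<and>
         Lambda_hom V (\<lambda>q. exp (V q)) = (SUP D \<in> diffusion_set V p a b. Lambda_hom V D)"
proof -
  let ?D = "\<lambda>q. exp (V q)"
  have mem: "?D \<in> diffusion_set V p a b"
    using assms by (intro exp_in_diffusion_set)
  have Z: "0 \<le> inverse (partition_const V)"
    by (simp add: partition_const_def)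
  have "weighted_diffusion V ?D = (\<lambda>_. 1)"
    by (simp add: weighted_diffusion_def fun_eq_iff flip: exp_add)
  \<comment> \<open>The factor 1 is kept so that comparing with \<open>D_hom V D\<close> amounts to
    \<open>A_hom \<le> 1\<close> multiplied by a nonnegative constant.\<close>
  then have hom_exp: "D_hom V ?D = inverse (partition_const V) * 1"
    unfolding D_hom_def by (simp only: A_hom_one)
  have le: "Lambda_hom V D \<le> Lambda_hom V ?D" if D: "D \<in> diffusion_set V p a b" for D
  proof (rule Lambda_hom_mono)
    interpret elliptic_coefficient "weighted_diffusion V D" a "inverse b"
      using assms D by (intro diffusion_set_elliptic)
    show "0 \<le> D_hom V D"
      unfolding D_hom_def by (intro mult_nonneg_nonneg Z A_hom_nonneg)
    show "D_hom V D \<le> D_hom V ?D"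
      unfolding hom_exp unfolding D_hom_def
      using assms D by (intro mult_left_mono A_hom_le_one Z)
  qed
  then have "bdd_above (Lambda_hom V ` diffusion_set V p a b)"
    by (intro bdd_aboveI2)
  moreover have "(SUP D \<in> diffusion_set V p a b. Lambda_hom V D) = Lambda_hom V ?D"
    by (rule cSup_eq_maximum) (use mem le in auto)
  ultimately show ?thesis using mem by simp
qed

end
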